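(* Suppose $f:\mathbb{R}^n\to\mathbb{R}$ is twice continuously differentiable, satisfies the concordant second-order Lipschitz condition with constant $\beta>0$, and attains its minimum; let $x^*$ be its minimal Euclidean-norm minimizer. For any given $\epsilon>0$, after at most $$K=\left\lceil\log_\tau\left(\frac{(1+3(\beta+1))\epsilon}{2(\beta+1)(1+\|\nabla f(0)\|^2)((3\beta+4)\|x^*\|+2)}\right)\right\rceil$$ outer iterations of the homotopy HSODM, where $$\tau=\frac{3(\beta+1)\left(1+\frac{1}{1+3(\beta+1)}+\|x^*\|\right)}{1+3(\beta+1)\left(1+\frac{1}{1+3(\beta+1)}+\|x^*\|\right)},$$ the output iterate $x_{K+1,0}$ satisfies $\|\nabla f(x_{K+1,0})\|\le\epsilon$.
   Context: Concordant second-order Lipschitz condition: there is a constant $\beta>0$ such that for any $x\in\operatorname{dom}(f)$, $\|\nabla f(x+d)-\nabla f(x)-\nabla^2f(x)d\|\le\beta\,d^T\nabla^2f(x)d$, where $d$ satisfies $\|d\|\le C$ for some $C>0$ and $x+d\in\operatorname{dom}(f)$. (Such $f$ is convex.) Homotopy HSODM. Notation $g_{k,j}=\nabla f(x_{k,j})$, $H_{k,j}=\nabla^2f(x_{k,j})$. Initialize $x_{0,0}=0$, $\mu_0=2(\beta+1)(1+\|g_{0,0}\|^2)$. For $k=0,1,\dots,K$: run the inner procedure from $x_{k,0}$ with $\mu_k$, obtaining $(x_{k,j},\rho_k)$; set $\mu_{k+1}=\rho_k\mu_k$ and $x_{k+1,0}=x_{k,j}$. Output $x_{K+1,0}$. Inner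 procedure: for $j=0,1,\dots$: if $\|g_{k,j}+\mu_kx_{k,j}\|\le\frac{\mu_k}{1+3(\beta+1)}$ (approximate centering condition), return $x_{k,j}$ and $\rho_k=\frac{3(\beta+1)(1+\|x_{k,j}\|)}{1+3(\beta+1)(1+\|x_{k,j}\|)}$; otherwise solve the generalized homogeneous model $$\min_{\|[v;t]\|\le1}\begin{bmatrix}v\\t\end{bmatrix}^T\begin{bmatrix}H_{k,j}&g_{k,j}+\mu_kx_{k,j}\\(g_{k,j}+\mu_kx_{k,j})^T&-\mu_k\end{bmatrix}\begin{bmatrix}v\\t\end{bmatrix}$$ with solution $[v_{k,j};t_{k,j}]$ and set $x_{k,j+1}=x_{k,j}+v_{k,j}/t_{k,j}$. *)

theory Defs
  imports "HOL-Analysis.Analysis"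
begin

definition grad :: "(real^'n \<Rightarrow> real) \<Rightarrow> real^'n \<Rightarrow> real^'n" where
  "grad f x = (THE D. GDERIV f x :> D)"

definition hessian :: "(real^'n \<Rightarrow> real) \<Rightarrow> real^'n \<Rightarrow> real^'n^'n" where
  "hessian f x = jacobian (grad f) (at x)"

definition twice_continuously_differentiable :: "(real^'n \<Rightarrow> real) \<Rightarrow> bool" where
  "twice_continuously_differentiable f \<longleftrightarrow>
     f differentiable_on UNIV \<and> grad f differentiable_on UNIV \<and> continuous_on UNIV (hessian f)"

lemma gderiv_grad:
  fixes f :: "real^'n \<Rightarrow> real"
  assumes "f differentiable (at x)"
  shows "GDERIV f x :> grad f x"
proof -
  obtain f' where f': "(f has_derivative f') (at x)"
    using assms unfolding differentiable_def by blast
  then have lin: "linear f'"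
    by (rule has_derivative_linear)
  define D where "D = adjoint f' 1"
  have "f' h = inner h D" for h
    using adjoint_works[OF lin, of h 1] by (simp add: D_def)
  then have "f' = (\<lambda>h. inner h D)" ..
  with f' have D: "GDERIV f x :> D"
    unfolding gderiv_def by (rule subst[rotated])
  have "E = D" if "GDERIV f x :> E" for E
  proof -
    have eq: "(\<lambda>h. inner h E) = (\<lambda>h. inner h D)"
      using that D unfolding gderiv_def by (rule has_derivative_unique)
    have "inner h E = inner h D" for h
      using fun_cong[OF eq, of h] .
    then show ?thesis
      using vector_eq_ldot[of E D] by blast
  qed
  with D show ?thesis
    unfolding grad_def by (rule theI)
qed

text \<open>The radius \<open>C\<close> is uniform in \<open>x\<close>, and the constant \<open>\<beta>\<close> may be tied to it. The domain of
  \<open>f\<close> is the whole space.\<close>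

definition concordant_second_order_Lipschitz :: "(real^'n \<Rightarrow> real) \<Rightarrow> real \<Rightarrow> bool" where
  "concordant_second_order_Lipschitz f \<beta> \<longleftrightarrow>
     \<beta> > 0 \<and>
     (\<exists>C>0. \<forall>x d. norm d \<le> C \<longrightarrow>
        norm (grad f (x + d) - grad f x - hessian f x *v d) \<le> \<beta> * (d \<bullet> (hessian f x *v d)))"

definition minimal_norm_minimizer :: "(real^'n \<Rightarrow> real) \<Rightarrow> real^'n \<Rightarrow> bool" where
  "minimal_norm_minimizer f z \<longleftrightarrow> is_arg_min norm (is_arg_min f (\<lambda>y. True)) z"

text \<open>The column vector \<open>[v;t]\<close> is a pair in \<open>real^'n \<times> real\<close>, whose norm and inner product are the
  Euclidean ones; \<open>ghm_apply H \<phi> \<mu>\<close> is multiplication by the block matrix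
  \<open>[H, \<phi>; \<phi>\<^sup>T, -\<mu>]\<close>.\<close>

definition ghm_apply :: "real^'n^'n \<Rightarrow> real^'n \<Rightarrow> real \<Rightarrow> (real^'n) \<times> real \<Rightarrow> (real^'n) \<times> real" where
  "ghm_apply H \<phi> \<mu> = (\<lambda>(v, t). (H *v v + t *\<^sub>R \<phi>, \<phi> \<bullet> v - \<mu> * t))"

definition ghm_solution :: "real^'n^'n \<Rightarrow> real^'n \<Rightarrow> real \<Rightarrow> (real^'n) \<times> real \<Rightarrow> bool" where
  "ghm_solution H \<phi> \<mu> w \<longleftrightarrow>
     is_arg_min (\<lambda>u. u \<bullet> ghm_apply H \<phi> \<mu> u) (\<lambda>u. norm u \<le> 1) w"

definition approx_centered :: "(real^'n \<Rightarrow> real) \<Rightarrow> real \<Rightarrow> real \<Rightarrow> real^'n \<Rightarrow> bool" where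
  "approx_centered f \<beta> \<mu> x \<longleftrightarrow> norm (grad f x + \<mu> *\<^sub>R x) \<le> \<mu> / (1 + 3 * (\<beta> + 1))"

text \<open>The requirement \<open>t \<noteq> 0\<close> only makes the division meaningful: it holds for every solution of the
  model when \<open>H\<close> is positive semidefinite and \<open>\<mu> > 0\<close>.\<close>

definition hsodm_step :: "(real^'n \<Rightarrow> real) \<Rightarrow> real \<Rightarrow> real^'n \<Rightarrow> real^'n \<Rightarrow> bool" where
  "hsodm_step f \<mu> x y \<longleftrightarrow>
     (\<exists>v t. ghm_solution (hessian f x) (grad f x + \<mu> *\<^sub>R x) \<mu> (v, t) \<and> t \<noteq> 0 \<and>
            y = x + (1 / t) *\<^sub>R v)"

definition homotopy_rho :: "real \<Rightarrow> real^'n \<Rightarrow> real" where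
  "homotopy_rho \<beta> x = 3 * (\<beta> + 1) * (1 + norm x) / (1 + 3 * (\<beta> + 1) * (1 + norm x))"

text \<open>A run of the outer loop \<open>k = 0, 1, \<dots>, K\<close>. The index \<open>J k\<close> is the first \<open>j\<close> at which the inner
  procedure of iteration \<open>k\<close> finds its iterate approximately centered, and so returns. A relation
  is used because the model may have several solutions. The loop bound \<open>K\<close> is an integer; for
  \<open>K < 0\<close> the loop is empty.\<close>

definition homotopy_hsodm_run ::
  "(real^'n \<Rightarrow> real) \<Rightarrow> real \<Rightarrow> int \<Rightarrow> (nat \<Rightarrow> nat \<Rightarrow> real^'n) \<Rightarrow> (nat \<Rightarrow> real) \<Rightarrow> (nat \<Rightarrow> nat) \<Rightarrow> bool"
where
  "homotopy_hsodm_run f \<beta> K x \<mu> J \<longleftrightarrow>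
     x 0 0 = 0 \<and>
     \<mu> 0 = 2 * (\<beta> + 1) * (1 + (norm (grad f (x 0 0)))\<^sup>2) \<and>
     (\<forall>k. int k \<le> K \<longrightarrow>
        (\<forall>j<J k. \<not> approx_centered f \<beta> (\<mu> k) (x k j) \<and>
                 hsodm_step f (\<mu> k) (x k j) (x k (Suc j))) \<and>
        approx_centered f \<beta> (\<mu> k) (x k (J k)) \<and>
        \<mu> (Suc k) = homotopy_rho \<beta> (x k (J k)) * \<mu> k \<and>
        x (Suc k) 0 = x k (J k))"

end

theory Submission
  imports Defs
begin

text \<open>
  Write \<open>M = 3 * (\<beta> + 1)\<close> and \<open>\<delta> = 1 / (1 + M)\<close>. The estimate rests on the centering test
  that an iterate passes when the inner procedure returns it.

  The concordant condition bounds a norm by a multiple of the quadratic form of the Hessian, so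
  that form is nonnegative and the gradient is monotone. A point \<open>x\<close> that passes the test for \<open>\<mu>\<close>
  satisfies \<open>grad f x = \<mu> (e - x)\<close> with \<open>norm e \<le> \<delta>\<close>. Since the gradient vanishes at \<open>x\<^sup>*\<close>,
  monotonicity reads \<open>(x - e) \<bullet> (x - x\<^sup>*) \<le> 0\<close>: the point \<open>x\<close> lies in the ball with diameter from
  \<open>e\<close> to \<open>x\<^sup>*\<close>. This gives at once \<open>norm x \<le> \<delta> + norm x\<^sup>*\<close> and
  \<open>norm (grad f x) \<le> \<mu> (2 \<delta> + norm x\<^sup>*)\<close> (lemmas \<open>norm_le_of_inner_nonpos\<close> and
  \<open>approx_centered_bounds\<close>).

  The first bound is uniform in the outer iteration, and the shrinking factor increases with the
  norm of the iterate, so every factor is at most \<open>\<tau> < 1\<close> and \<open>\<mu>\<^sub>k \<le> \<tau>\<^sup>k \<mu>\<^sub>0\<close>. The second bound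
  then makes the gradient as small as \<open>\<mu>\<^sub>K\<close>, and \<open>K\<close> is the least integer with
  \<open>\<tau>\<^sup>K \<mu>\<^sub>0 (2 \<delta> + norm x\<^sup>*) \<le> \<epsilon>\<close>. If \<open>K\<close> is negative, the output is the starting point \<open>0\<close>; then
  \<open>\<epsilon>\<close> is at least \<open>2 \<delta> \<mu>\<^sub>0\<close>, and the choice of \<open>\<mu>\<^sub>0\<close> as a multiple of \<open>1 + (norm (grad f 0))\<^sup>2\<close> makes
  that no less than \<open>norm (grad f 0)\<close>.
\<close>

section \<open>Monotonicity of the gradient\<close>

text \<open>The condition gives the sign for short vectors only; the form is homogeneous of degree two,
  so every vector can first be scaled to have norm at most \<open>C\<close>.\<close>

lemma concordant_hessian_nonneg:
  fixes f :: "real^'n \<Rightarrow> real"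
  assumes "concordant_second_order_Lipschitz f \<beta>"
  shows "0 \<le> d \<bullet> (hessian f x *v d)"
proof -
  obtain C where "\<beta> > 0" "C > 0" and C: "\<And>x d. norm d \<le> C \<Longrightarrow>
      norm (grad f (x + d) - grad f x - hessian f x *v d) \<le> \<beta> * (d \<bullet> (hessian f x *v d))"
    using assms unfolding concordant_second_order_Lipschitz_def by blast
  define s where "s = C / (norm d + 1)"
  have s: "s > 0"
    using \<open>C > 0\<close> by (simp add: s_def add_nonneg_pos)
  have "norm (s *\<^sub>R d) \<le> C"
    using \<open>C > 0\<close> by (simp add: s_def divide_le_eq add_nonneg_pos)
  from order_trans[OF norm_ge_zero C[OF this]]
  have "0 \<le> \<beta> * (s\<^sup>2 * (d \<bullet> (hessian f x *v d)))"
    by (simp add: matrix_vector_mult_scaleR power2_eq_square mult.assoc)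
  then show ?thesis
    using \<open>\<beta> > 0\<close> s by (simp add: zero_le_mult_iff)
qed

lemma grad_monotone:
  fixes f :: "real^'n \<Rightarrow> real"
  assumes "twice_continuously_differentiable f"
    and "concordant_second_order_Lipschitz f \<beta>"
  shows "0 \<le> (grad f x - grad f y) \<bullet> (x - y)"
proof -
  define d where "d = x - y"
  define h where "h t = grad f (y + t *\<^sub>R d) \<bullet> d" for t :: real
  have der: "(h has_real_derivative (d \<bullet> (hessian f (y + t *\<^sub>R d) *v d))) (at t)" for t
  proof -
    have "grad f differentiable (at (y + t *\<^sub>R d))"
      using assms(1) unfolding twice_continuously_differentiable_def
      by (simp add: differentiable_on_def)
    then have G: "(grad f has_derivative (*v) (hessian f (y + t *\<^sub>R d))) (at (y + t *\<^sub>R d))"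
      unfolding hessian_def using jacobian_works by blast
    have L: "((\<lambda>t. y + t *\<^sub>R d) has_derivative (\<lambda>s. s *\<^sub>R d)) (at t)"
      by (auto intro!: derivative_eq_intros)
    have "(h has_derivative (\<lambda>s. (hessian f (y + t *\<^sub>R d) *v (s *\<^sub>R d)) \<bullet> d)) (at t)"
      unfolding h_def
      using has_derivative_inner_left[OF has_derivative_compose[OF L G], of d] .
    moreover have "(\<lambda>s. (hessian f (y + t *\<^sub>R d) *v (s *\<^sub>R d)) \<bullet> d)
        = (*) (d \<bullet> (hessian f (y + t *\<^sub>R d) *v d))"
      by (auto simp: matrix_vector_mult_scaleR inner_commute)
    ultimately show ?thesis
      by (simp add: has_field_derivative_def)
  qed
  have "h 0 \<le> h 1"
    by (rule DERIV_nonneg_imp_nondecreasing[where f = h])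
      (use der concordant_hessian_nonneg[OF assms(2)] in \<open>simp, blast\<close>)
  then show ?thesis
    by (simp add: h_def d_def inner_diff_left)
qed

lemma grad_eq_0_minimizer:
  fixes f :: "real^'n \<Rightarrow> real"
  assumes "f differentiable (at z)" and "\<And>y. f z \<le> f y"
  shows "grad f z = 0"
proof -
  have "(f has_derivative (\<lambda>h. h \<bullet> grad f z)) (at z)"
    using gderiv_grad[OF assms(1)] by (simp add: gderiv_def)
  then have "(\<lambda>h. h \<bullet> grad f z) = (\<lambda>h. 0)"
    by (rule differential_zero_maxmin[OF UNIV_I open_UNIV]) (use assms(2) in auto)
  then have "grad f z \<bullet> grad f z = 0"
    by (rule fun_cong)
  then show ?thesis
    by simp
qed

section \<open>Approximately centered points\<close>

text \<open>By Thales, the hypothesis says that \<open>x\<close> lies in the ball with centre \<open>(e + z) / 2\<close> and radius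
  \<open>norm (e - z) / 2\<close>. Expanding the inner product and using Cauchy--Schwarz on each term would lose
  a constant factor, which the rate \<open>\<tau>\<close> leaves no room for.\<close>

lemma norm_le_of_inner_nonpos:
  fixes x e z :: "'a::real_inner"
  assumes "(x - e) \<bullet> (x - z) \<le> 0"
  shows "norm x \<le> norm e + norm z"
proof -
  have "(norm (2 *\<^sub>R x - (e + z)))\<^sup>2 = (norm (e - z))\<^sup>2 + 4 * ((x - e) \<bullet> (x - z))"
    by (simp add: power2_norm_eq_inner inner_commute inner_simps)
  then have "(norm (2 *\<^sub>R x - (e + z)))\<^sup>2 \<le> (norm (e - z))\<^sup>2"
    using assms by linarith
  then have "norm (2 *\<^sub>R x - (e + z)) \<le> norm (e - z)"
    by (rule power2_le_imp_le) simp
  moreover have "norm (2 *\<^sub>R x) \<le> norm (2 *\<^sub>R x - (e + z)) + norm (e + z)"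
    using norm_triangle_ineq[of "2 *\<^sub>R x - (e + z)" "e + z"] by simp
  moreover have "norm (e - z) \<le> norm e + norm z" "norm (e + z) \<le> norm e + norm z"
    by (rule norm_triangle_ineq4, rule norm_triangle_ineq)
  ultimately show ?thesis
    by simp
qed

lemma approx_centered_bounds:
  fixes f :: "real^'n \<Rightarrow> real"
  assumes mono: "0 \<le> (grad f x - grad f z) \<bullet> (x - z)" and z: "grad f z = 0"
    and "\<mu> > 0" and "\<beta> > 0" and centered: "approx_centered f \<beta> \<mu> x"
  shows "norm x \<le> 1 / (1 + 3 * (\<beta> + 1)) + norm z"
    and "norm (grad f x) \<le> \<mu> * (2 / (1 + 3 * (\<beta> + 1)) + norm z)"
proof -
  define \<delta> where "\<delta> = 1 / (1 + 3 * (\<beta> + 1))"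
  define e where "e = (1 / \<mu>) *\<^sub>R (grad f x + \<mu> *\<^sub>R x)"
  have g: "grad f x = \<mu> *\<^sub>R (e - x)"
    using \<open>\<mu> > 0\<close> by (simp add: e_def algebra_simps)
  have "norm (grad f x + \<mu> *\<^sub>R x) \<le> \<delta> * \<mu>"
    using centered by (simp add: approx_centered_def \<delta>_def)
  then have e: "norm e \<le> \<delta>"
    using \<open>\<mu> > 0\<close> by (simp add: e_def pos_divide_le_eq)
  have "0 \<le> \<mu> * ((e - x) \<bullet> (x - z))"
    using mono by (simp add: z g)
  then have "0 \<le> (e - x) \<bullet> (x - z)"
    using \<open>\<mu> > 0\<close> by (simp add: zero_le_mult_iff)
  then have "(x - e) \<bullet> (x - z) \<le> 0"
    by (simp add: inner_diff_left)
  then have "norm x \<le> norm e + norm z"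
    by (rule norm_le_of_inner_nonpos)
  with e have x: "norm x \<le> \<delta> + norm z"
    by simp
  then show "norm x \<le> 1 / (1 + 3 * (\<beta> + 1)) + norm z"
    by (simp add: \<delta>_def)
  have "norm (e - x) \<le> 2 * \<delta> + norm z"
    using norm_triangle_ineq4[of e x] e x by simp
  then have "norm (grad f x) \<le> \<mu> * (2 * \<delta> + norm z)"
    using \<open>\<mu> > 0\<close> by (simp add: g)
  then show "norm (grad f x) \<le> \<mu> * (2 / (1 + 3 * (\<beta> + 1)) + norm z)"
    by (simp add: \<delta>_def)
qed

section \<open>Geometric decrease of the homotopy parameter\<close>

lemma ratio_mono:
  fixes a b :: real
  assumes "0 \<le> a" and "a \<le> b"
  shows "a / (1 + a) \<le> b / (1 + b)"
proof -
  have "c / (1 + c) = 1 - 1 / (1 + c)" if "0 \<le> c" for c :: real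
    using that by (simp add: field_simps)
  moreover have "1 / (1 + b) \<le> 1 / (1 + a)"
    using assms by (intro frac_le) auto
  ultimately show ?thesis
    using assms by simp
qed

lemma homotopy_rho_pos:
  assumes "\<beta> > 0"
  shows "0 < homotopy_rho \<beta> x"
proof -
  have "0 < 3 * (\<beta> + 1) * (1 + norm x)"
    using assms by (intro mult_pos_pos) (auto simp: add_pos_nonneg)
  then show ?thesis
    by (simp add: homotopy_rho_def)
qed

text \<open>The bound \<open>R\<close> on the returned iterate is available only once \<open>\<mu> k\<close> is known to be positive,
  and positivity passes along the same recursion; so one induction proves the two claims together.\<close>

lemma homotopy_run_mu_bound:
  fixes f :: "real^'n \<Rightarrow> real"
  assumes run: "homotopy_hsodm_run f \<beta> K x \<mu> J" and "\<beta> > 0"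
    and bound: "\<And>m y. m > 0 \<Longrightarrow> approx_centered f \<beta> m y \<Longrightarrow> norm y \<le> R"
    and "0 \<le> R"
    and "int k \<le> K"
  shows "0 < \<mu> k \<and> \<mu> k \<le> (3 * (\<beta> + 1) * (1 + R) / (1 + 3 * (\<beta> + 1) * (1 + R))) ^ k * \<mu> 0"
  using \<open>int k \<le> K\<close>
proof (induction k)
  case 0
  have "0 < 2 * (\<beta> + 1) * (1 + (norm (grad f (x 0 0)))\<^sup>2)"
    using \<open>\<beta> > 0\<close> by (intro mult_pos_pos) (auto simp: add_pos_nonneg)
  with run show ?case
    by (simp add: homotopy_hsodm_run_def)
next
  case (Suc k)
  define y where "y = x k (J k)"
  define \<tau> where "\<tau> = 3 * (\<beta> + 1) * (1 + R) / (1 + 3 * (\<beta> + 1) * (1 + R))"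
  have IH: "0 < \<mu> k" "\<mu> k \<le> \<tau> ^ k * \<mu> 0"
    using Suc by (auto simp: \<tau>_def)
  have "approx_centered f \<beta> (\<mu> k) y" and step: "\<mu> (Suc k) = homotopy_rho \<beta> y * \<mu> k"
    using run Suc.prems by (auto simp: homotopy_hsodm_run_def y_def)
  then have y: "norm y \<le> R"
    using bound IH(1) by blast
  have rho: "homotopy_rho \<beta> y \<le> \<tau>"
    unfolding homotopy_rho_def \<tau>_def
    by (rule ratio_mono) (use y \<open>\<beta> > 0\<close> in \<open>auto intro!: mult_left_mono mult_nonneg_nonneg\<close>)
  have "homotopy_rho \<beta> y * \<mu> k \<le> \<tau> * (\<tau> ^ k * \<mu> 0)"
    using rho IH homotopy_rho_pos[OF \<open>\<beta> > 0\<close>, of y] by (intro mult_mono) auto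
  then show ?case
    using step IH(1) homotopy_rho_pos[OF \<open>\<beta> > 0\<close>, of y]
    by (simp add: \<tau>_def mult.assoc)
qed

theorem lemma4p7:
  fixes f :: "real^'n \<Rightarrow> real"
    and \<beta> \<epsilon> \<tau> :: real
    and K :: int
    and xstar :: "real^'n"
    and x :: "nat \<Rightarrow> nat \<Rightarrow> real^'n"
    and \<mu> :: "nat \<Rightarrow> real"
    and J :: "nat \<Rightarrow> nat"
  assumes "twice_continuously_differentiable f"
    and "concordant_second_order_Lipschitz f \<beta>"
    and "minimal_norm_minimizer f xstar"
    and "\<epsilon> > 0"
    and "\<tau> = 3 * (\<beta> + 1) * (1 + 1 / (1 + 3 * (\<beta> + 1)) + norm xstar) /
             (1 + 3 * (\<beta> + 1) * (1 + 1 / (1 + 3 * (\<beta> + 1)) + norm xstar))"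
    and "K = \<lceil>log \<tau> ((1 + 3 * (\<beta> + 1)) * \<epsilon> /
              (2 * (\<beta> + 1) * (1 + (norm (grad f 0))\<^sup>2) * ((3 * \<beta> + 4) * norm xstar + 2)))\<rceil>"
    and "homotopy_hsodm_run f \<beta> K x \<mu> J"
  shows "norm (grad f (x (nat (K + 1)) 0)) \<le> \<epsilon>"
proof -
  note run = assms(7)
  define c where "c = 1 + 3 * (\<beta> + 1)"
  define m where "m = 2 * (\<beta> + 1) * (1 + (norm (grad f 0))\<^sup>2)"
  define D where "D = c * norm xstar + 2"
  define A where "A = c * \<epsilon> / (m * D)"
  define R where "R = 1 / c + norm xstar"
  have \<beta>: "\<beta> > 0"
    using assms(2) by (simp add: concordant_second_order_Lipschitz_def)
  have c: "c > 0"
    using \<beta> by (simp add: c_def)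
  have m: "m > 0"
    unfolding m_def using \<beta> by (intro mult_pos_pos) (auto simp: add_pos_nonneg)
  have D: "D \<ge> 2"
    using c by (simp add: D_def)
  have A: "A > 0"
    unfolding A_def using c m D \<open>\<epsilon> > 0\<close> by (intro divide_pos_pos mult_pos_pos) auto
  have R: "R \<ge> 0"
    using c by (simp add: R_def)
  have \<tau>: "\<tau> = 3 * (\<beta> + 1) * (1 + R) / (1 + 3 * (\<beta> + 1) * (1 + R))"
    using assms(5) by (simp add: R_def c_def add.assoc)
  have "0 < 3 * (\<beta> + 1) * (1 + R)"
    using \<beta> R by (intro mult_pos_pos) auto
  then have \<tau>0: "0 < \<tau>" and \<tau>1: "\<tau> < 1"
    by (auto simp: \<tau>)
  have K: "K = \<lceil>log \<tau> A\<rceil>"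
    using assms(6) by (simp add: A_def m_def D_def c_def algebra_simps)
  \<comment> \<open>The base is below \<open>1\<close>, so a lower bound on the logarithm is an upper bound on the power.\<close>
  have log_le: "\<tau> powr s \<le> A" if "log \<tau> A \<le> s" for s
  proof -
    have "\<tau> powr s \<le> \<tau> powr (log \<tau> A)"
      using that \<tau>0 \<tau>1 by (simp add: powr_mono')
    then show ?thesis
      using \<tau>0 \<tau>1 A by simp
  qed
  have "f differentiable (at xstar)" "\<And>y. f xstar \<le> f y"
    using assms(1,3)
    by (auto simp: twice_continuously_differentiable_def differentiable_on_def
        minimal_norm_minimizer_def is_arg_min_def not_less)
  then have gz: "grad f xstar = 0"
    by (rule grad_eq_0_minimizer)
  note bounds = approx_centered_bounds[OF grad_monotone[OF assms(1,2)] gz _ \<beta>, folded c_def]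
  show ?thesis
  proof (cases "K \<ge> 0")
    case True
    define k where "k = nat K"
    have k: "int k = K" "nat (K + 1) = Suc k"
      using True by (auto simp: k_def)
    have out: "x (Suc k) 0 = x k (J k)" and centered: "approx_centered f \<beta> (\<mu> k) (x k (J k))"
      and \<mu>0: "\<mu> 0 = m"
      using run k by (auto simp: homotopy_hsodm_run_def m_def)
    have \<mu>: "0 < \<mu> k" "\<mu> k \<le> \<tau> ^ k * m"
      using homotopy_run_mu_bound[OF run \<beta> _ R, of k, folded \<tau>] bounds(1)[folded R_def] k(1) \<mu>0
      by simp_all
    have "log \<tau> A \<le> real k"
      using K k by linarith
    then have "\<tau> ^ k \<le> A"
      using log_le[of "real k"] \<tau>0 by (simp add: powr_realpow)
    then have "\<mu> k \<le> A * m"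
      using \<mu>(2) m by (meson mult_right_mono less_imp_le order_trans)
    have "norm (grad f (x k (J k))) \<le> \<mu> k * (2 / c + norm xstar)"
      using bounds(2)[OF \<mu>(1) centered] .
    also have "\<dots> \<le> A * m * (2 / c + norm xstar)"
      using \<open>\<mu> k \<le> A * m\<close> c by (intro mult_right_mono) auto
    also have "2 / c + norm xstar = D / c"
      using c by (simp add: D_def field_simps)
    also have "A * m * (D / c) = \<epsilon>"
      using c m D by (simp add: A_def)
    finally show ?thesis
      by (simp add: k out)
  next
    case False
    have out: "x (nat (K + 1)) 0 = 0"
      using False run by (simp add: homotopy_hsodm_run_def)
    have "log \<tau> A \<le> 0"
      using K False by linarith
    then have "1 \<le> A"
      using log_le[of 0] \<tau>0 by simp
    then have "m * D \<le> c * \<epsilon>"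
      using m D by (simp add: A_def le_divide_eq)
    moreover have "m * 2 \<le> m * D"
      using m D by simp
    \<comment> \<open>By \<open>2 t \<le> 1 + t\<^sup>2\<close> the initial \<open>m\<close> is at least \<open>4 (\<beta> + 1) t\<close>, while \<open>c = 3 \<beta> + 4\<close>.\<close>
    moreover have "c * norm (grad f 0) \<le> m * 2"
    proof -
      define t where "t = norm (grad f 0)"
      have "0 \<le> (1 - t)\<^sup>2"
        by simp
      then have "2 * t \<le> 1 + t\<^sup>2"
        by (simp add: power2_eq_square algebra_simps)
      then have "4 * (\<beta> + 1) * (2 * t) \<le> 4 * (\<beta> + 1) * (1 + t\<^sup>2)"
        using \<beta> by (intro mult_left_mono) auto
      moreover have "c * t \<le> 8 * (\<beta> + 1) * t"
        using \<beta> by (intro mult_right_mono) (auto simp: c_def t_def)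
      ultimately show ?thesis
        by (simp add: m_def t_def[symmetric] algebra_simps)
    qed
    ultimately have "c * norm (grad f 0) \<le> c * \<epsilon>"
      by linarith
    then show ?thesis
      using c by (simp add: out)
  qed
qed

end
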